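(* Let $D=(d_{ij})$ be an $n\times n$, $n\ge 4$, Euclidean distance matrix of embedding dimension $r\le n-2$, and let $z^1,\ldots,z^n\in\mathbb{R}^{n-r-1}$ be Gale transforms of the generating points of $D$. Let $i,j,k$ be three distinct indices in $\{1,\ldots,n\}$ and let $d_{ij}$ and $d_{ik}$ be two unyielding entries of $D$. Then $d_{ij}$ and $d_{ik}$ are jointly yielding if and only if there exist nonzero scalars $c_1$ and $c_2$ such that $z^i=c_1z^j+c_2z^k$.
   Context: An $n\times n$ real matrix $D=(d_{ij})$ is a Euclidean distance matrix (EDM) if there exist points $p^1,\ldots,p^n$ in some Euclidean space with $d_{ij}=\|p^i-p^j\|^2$ for all $i,j$; such points are generating points of $D$, and the dimension of their affine span is the embedding dimension $r$ of $D$. For $i\ne j$, $E^{ij}$ is the $n\times n$ symmetric matrix with 1's in the $ij$th and $ji$th entries and 0's elsewhere. For an off-diagonal entry $d_{ij}$, let $[l_{ij},u_{ij}]$ (with $l_{ij}\le 0\le u_{ij}$) be the closed interval such that $D+tE^{ij}$ is an EDM if and only if $l_{ij}\le t\le u_{ij}$. The entry $d_{ij}$ is unyielding if $l_{ij}=u_{ij}=0$, and yielding otherwise. Two unyielding entries $d_{ij}$ and $d_{ik}$ (in the same row/column) are jointly yielding if $D+t_1E^{ij}+t_2E^{ik}$ is an EDM for some nonzero scalars $t_1$ and $t_2$; otherwise they are jointly unyielding. Let $e\in\mathbb{R}^n$ be the all-ones vector, $J=I_n-ee^T/n$, and $B=-\frac12 JDJ$, which is positive semidefinite of rank $r$. A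 configuration matrix of $D$ is an $n\times r$ matrix $P$ with $B=PP^T$ (so $P$ has rank $r$ and $P^Te=0$); its rows are $(p^1)^T,\ldots,(p^n)^T$, giving generating points of $D$. For $r\le n-2$, a Gale matrix of $D$ is an $n\times(n-r-1)$ matrix $Z$ whose columns form a basis of the null space of $\begin{bmatrix}P^T\\ e^T\end{bmatrix}$ (equivalently of $\begin{bmatrix}B\\ e^T\end{bmatrix}$); its rows are $(z^1)^T,\ldots,(z^n)^T$, and $z^1,\ldots,z^n$ are called Gale transforms of $p^1,\ldots,p^n$. *)

theory Defs
  imports "HOL-Analysis.Analysis"
begin

definition generating_points :: "real^'n^'n \<Rightarrow> ('n \<Rightarrow> 'a::euclidean_space) \<Rightarrow> bool" where
  "generating_points D p \<longleftrightarrow> (\<forall>i j. D $ i $ j = (norm (p i - p j))\<^sup>2)"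

text \<open>The definition of an EDM allows points in an arbitrary Euclidean space. HOL cannot quantify
  over types inside a formula, so the points are placed in \<open>real^'n\<close>; lemma
  \<open>is_EDM_if_generating_points\<close> below shows that this loses no generality.\<close>

definition is_EDM :: "real^'n^'n \<Rightarrow> bool" where
  "is_EDM D \<longleftrightarrow> (\<exists>p :: 'n \<Rightarrow> real^'n. generating_points D p)"

text \<open>Lemma \<open>embedding_dim_eq\<close> below shows that the value does not depend on the generating points,
  nor on the Euclidean space they live in.\<close>

definition embedding_dim :: "real^'n^'n \<Rightarrow> nat" where
  "embedding_dim D =
     (THE r. \<exists>p :: 'n \<Rightarrow> real^'n. generating_points D p \<and> aff_dim (range p) = int r)"

definition Emat :: "'n \<Rightarrow> 'n \<Rightarrow> real^'n^'n" where
  "Emat i j = (\<chi> a b. if (a = i \<and> b = j) \<or> (a = j \<and> b = i) then 1 else 0)"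

text \<open>\<open>yielding_interval D i j l u\<close>: the closed interval \<open>[l, u]\<close> is the set of all \<open>t\<close> for which
  \<open>D + t E\<^sup>i\<^sup>j\<close> is an EDM. Such \<open>l \<le> 0 \<le> u\<close> are unique.\<close>

definition yielding_interval :: "real^'n^'n \<Rightarrow> 'n \<Rightarrow> 'n \<Rightarrow> real \<Rightarrow> real \<Rightarrow> bool" where
  "yielding_interval D i j l u \<longleftrightarrow>
     l \<le> 0 \<and> 0 \<le> u \<and> (\<forall>t. is_EDM (D + t *\<^sub>R Emat i j) \<longleftrightarrow> l \<le> t \<and> t \<le> u)"

definition unyielding :: "real^'n^'n \<Rightarrow> 'n \<Rightarrow> 'n \<Rightarrow> bool" where
  "unyielding D i j \<longleftrightarrow> (\<exists>l u. yielding_interval D i j l u \<and> l = 0 \<and> u = 0)"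

definition jointly_yielding :: "real^'n^'n \<Rightarrow> 'n \<Rightarrow> 'n \<Rightarrow> 'n \<Rightarrow> bool" where
  "jointly_yielding D i j k \<longleftrightarrow>
     (\<exists>t1 t2. t1 \<noteq> 0 \<and> t2 \<noteq> 0 \<and> is_EDM (D + t1 *\<^sub>R Emat i j + t2 *\<^sub>R Emat i k))"

definition Jmat :: "real^'n^'n" where
  "Jmat = mat 1 - (\<chi> a b. 1 / real CARD('n))"

definition Bmat :: "real^'n^'n \<Rightarrow> real^'n^'n" where
  "Bmat D = (- 1 / 2) *\<^sub>R (Jmat ** D ** Jmat)"

text \<open>An \<open>n \<times> r\<close> matrix \<open>P\<close> is represented by its entries \<open>P a s\<close> with \<open>s < r\<close> (entries with
  \<open>s \<ge> r\<close> are never used). A type-indexed matrix would exclude the case \<open>r = 0\<close>.\<close>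

definition configuration_matrix :: "real^'n^'n \<Rightarrow> ('n \<Rightarrow> nat \<Rightarrow> real) \<Rightarrow> bool" where
  "configuration_matrix D P \<longleftrightarrow>
     (\<forall>a b. Bmat D $ a $ b = (\<Sum>s < embedding_dim D. P a s * P b s))"

text \<open>The null space of the matrix obtained by stacking \<open>P\<^sup>T\<close> on top of \<open>e\<^sup>T\<close>, where \<open>P\<close> has
  \<open>r\<close> columns.\<close>

definition gale_space :: "nat \<Rightarrow> ('n \<Rightarrow> nat \<Rightarrow> real) \<Rightarrow> (real^'n) set" where
  "gale_space r P = {x. (\<forall>s < r. (\<Sum>a\<in>UNIV. P a s * x $ a) = 0) \<and> (\<Sum>a\<in>UNIV. x $ a) = 0}"

text \<open>The columns of \<open>Z\<close> form a basis of the null space; its rows \<open>Z $ i\<close> are the Gale transforms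
  of the rows of \<open>P\<close>.\<close>

definition gale_matrix :: "real^'n^'n \<Rightarrow> ('n \<Rightarrow> nat \<Rightarrow> real) \<Rightarrow> real^'m^'n \<Rightarrow> bool" where
  "gale_matrix D P Z \<longleftrightarrow>
     inj (\<lambda>c. column c Z) \<and> independent (range (\<lambda>c. column c Z)) \<and>
     span (range (\<lambda>c. column c Z)) = gale_space (embedding_dim D) P"

lemma is_EDM_if_generating_points:
  fixes D :: "real^'n^'n" and p :: "'n \<Rightarrow> 'a::euclidean_space"
  assumes "generating_points D p"
  shows "is_EDM D"
proof -
  obtain a :: 'n where True by simp
  let ?S = "span ((\<lambda>i. p i - p a) ` (UNIV - {a}))"
  have "dim ?S \<le> card ((\<lambda>i. p i - p a) ` (UNIV - {a}))"
    by (simp add: dim_le_card')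
  also have "\<dots> \<le> CARD('n)"
    by (rule order_trans[OF card_image_le]) (simp_all add: card_mono)
  finally have "dim ?S \<le> dim (UNIV :: (real^'n) set)" by simp
  then obtain f :: "'a \<Rightarrow> real^'n" where f: "linear f" "\<And>x. x \<in> ?S \<Longrightarrow> norm (f x) = norm x"
    using isometry_subset_subspace[of ?S "UNIV :: (real^'n) set"] by auto
  have mem: "p i - p a \<in> ?S" for i
    by (cases "i = a") (auto intro: span_base span_zero)
  have "norm (f (p i) - f (p j)) = norm (p i - p j)" for i j
    using f(2)[OF span_diff[OF mem[of i] mem[of j]]] linear_diff[OF f(1)] by simp
  then show ?thesis
    using assms unfolding is_EDM_def generating_points_def
    by (intro exI[of _ "\<lambda>i. f (p i)"]) simp
qed

lemma dim_range_le_if_inner_eq: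
  fixes u :: "'n::finite \<Rightarrow> 'a::euclidean_space" and v :: "'n \<Rightarrow> 'b::euclidean_space"
  assumes eq: "\<And>i j. u i \<bullet> u j = v i \<bullet> v j"
  shows "dim (range u) \<le> dim (range v)"
proof -
  obtain B where B: "B \<subseteq> range u" "independent B" "card B = dim (range u)"
    using basis_exists[of "range u"] by metis
  define g where "g = inv u"
  have ug: "u (g b) = b" if "b \<in> B" for b
    using that B(1) by (auto simp: g_def f_inv_into_f)
  have fB: "finite B" using B(2) by (rule independent_imp_finite)
  have nrm: "(\<Sum>b\<in>B. c b *\<^sub>R b) \<bullet> (\<Sum>b\<in>B. c b *\<^sub>R b)
      = (\<Sum>b\<in>B. c b *\<^sub>R v (g b)) \<bullet> (\<Sum>b\<in>B. c b *\<^sub>R v (g b))" for c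
    unfolding inner_sum_left inner_sum_right inner_scaleR_left inner_scaleR_right
    by (intro sum.cong refl arg_cong2[where f = "(*)"]) (simp add: eq[symmetric] ug)
  have zero: "c b = 0" if "(\<Sum>b\<in>B. c b *\<^sub>R v (g b)) = 0" "b \<in> B" for c b
  proof -
    have "(\<Sum>b\<in>B. c b *\<^sub>R b) = 0"
      using nrm[of c] that(1) by simp
    then show ?thesis using B(2) fB that(2) by (auto simp: independent_explicit)
  qed
  have inj: "inj_on (\<lambda>b. v (g b)) B"
  proof (rule inj_onI)
    fix x y assume xy: "x \<in> B" "y \<in> B" "v (g x) = v (g y)"
    have "(u (g x) - u (g y)) \<bullet> (u (g x) - u (g y))
        = (v (g x) - v (g y)) \<bullet> (v (g x) - v (g y))"
      by (simp add: inner_diff_left inner_diff_right eq)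
    then show "x = y" using xy ug by simp
  qed
  have "independent ((\<lambda>b. v (g b)) ` B)"
    unfolding independent_explicit
  proof (intro conjI allI impI ballI)
    show "finite ((\<lambda>b. v (g b)) ` B)" using fB by simp
    fix c w assume s: "(\<Sum>w\<in>(\<lambda>b. v (g b)) ` B. c w *\<^sub>R w) = 0" and "w \<in> (\<lambda>b. v (g b)) ` B"
    then obtain b where b: "b \<in> B" "w = v (g b)" by auto
    have "(\<Sum>b\<in>B. c (v (g b)) *\<^sub>R v (g b)) = 0"
      using s by (simp add: sum.reindex[OF inj])
    from zero[OF this b(1)] b(2) show "c w = 0" by simp
  qed
  then have "card ((\<lambda>b. v (g b)) ` B) \<le> dim (range v)"
    by (intro independent_card_le_dim) auto
  then show ?thesis using card_image[OF inj] B(3) by simp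
qed

lemma aff_dim_generating_points_le:
  fixes D :: "real^'n^'n" and p :: "'n \<Rightarrow> 'a::euclidean_space" and q :: "'n \<Rightarrow> 'b::euclidean_space"
  assumes p: "generating_points D p" and q: "generating_points D q"
  shows "aff_dim (range p) \<le> aff_dim (range q)"
proof -
  obtain a :: 'n where True by simp
  have nrm: "norm (p i - p j) = norm (q i - q j)" for i j
    proof (rule power2_eq_imp_eq)
    show "(norm (p i - p j))\<^sup>2 = (norm (q i - q j))\<^sup>2"
      using p q by (simp add: generating_points_def)
  qed simp_all
  have pol: "x \<bullet> y = ((norm x)\<^sup>2 + (norm y)\<^sup>2 - (norm (x - y))\<^sup>2) / 2" for x y :: "'c::euclidean_space"
    by (simp add: power2_norm_eq_inner inner_diff_left inner_diff_right inner_commute)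
  have "(p i - p a) \<bullet> (p j - p a) = (q i - q a) \<bullet> (q j - q a)" for i j
    unfolding pol by (simp add: nrm)
  then have "dim (range (\<lambda>i. p i - p a)) \<le> dim (range (\<lambda>i. q i - q a))"
    by (rule dim_range_le_if_inner_eq)
  moreover have "aff_dim (range p) = int (dim (range (\<lambda>i. p i - p a)))"
    using aff_dim_eq_dim_subtract[of "p a" "range p"] by (simp add: hull_inc image_image)
  moreover have "aff_dim (range q) = int (dim (range (\<lambda>i. q i - q a)))"
    using aff_dim_eq_dim_subtract[of "q a" "range q"] by (simp add: hull_inc image_image)
  ultimately show ?thesis by simp
qed

lemma embedding_dim_eq:
  fixes D :: "real^'n^'n" and p :: "'n \<Rightarrow> 'a::euclidean_space"
  assumes p: "generating_points D p"
  shows "aff_dim (range p) = int (embedding_dim D)"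
proof -
  obtain q :: "'n \<Rightarrow> real^'n" where q: "generating_points D q"
    using is_EDM_if_generating_points[OF p] unfolding is_EDM_def by blast
  have eq: "aff_dim (range q') = aff_dim (range p)" if "generating_points D q'"
    for q' :: "'n \<Rightarrow> real^'n"
    using aff_dim_generating_points_le[OF p that] aff_dim_generating_points_le[OF that p] by simp
  have "aff_dim (range p) \<ge> 0"
    using aff_dim_negative_iff[of "range p"] by (simp add: not_less[symmetric])
  then obtain r where r: "aff_dim (range p) = int r" by (metis nonneg_int_cases)
  have "embedding_dim D = r"
    unfolding embedding_dim_def
  proof (rule the_equality)
    show "\<exists>p::'n \<Rightarrow> real^'n. generating_points D p \<and> aff_dim (range p) = int r"
      using q eq r by auto
  next
    fix s assume "\<exists>p::'n \<Rightarrow> real^'n. generating_points D p \<and> aff_dim (range p) = int s"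
    then show "s = r" using eq r by auto
  qed
  then show ?thesis using r by simp
qed

end

theory Submission
  imports Defs
begin

text \<open>
  On vectors \<open>x\<close> with coordinate sum \<open>0\<close> the quadratic form of an EDM is
  \<open>x\<^sup>T D x = -2 |\<Sum> x\<^sub>a p\<^sup>a|\<^sup>2\<close>, hence negative semidefinite, and its zeros are exactly the affine
  dependencies of the generating points. These zeros form the Gale space
  (\<open>gale_space_iff_isotropic\<close>), so they are the vectors with entries \<open>x\<^sub>a = z\<^sup>a \<bullet> v\<close>. Adding
  \<open>t1 E\<^sup>i\<^sup>j + t2 E\<^sup>i\<^sup>k\<close> adds \<open>2 x\<^sub>i (t1 x\<^sub>j + t2 x\<^sub>k)\<close> to the form.

  If the perturbed matrix is an EDM, then evaluating its form on the Gale space gives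
  \<open>(z\<^sup>i \<bullet> v) (w \<bullet> v) \<le> 0\<close> for all \<open>v\<close>, where \<open>w = t1 z\<^sup>j + t2 z\<^sup>k\<close>. A product of two nonzero linear
  functionals is nonpositive only if they are negative multiples of one another, which is the
  required relation (\<open>product_nonpos_imp_opposite\<close>). If \<open>z\<^sup>i\<close> or \<open>w\<close> vanishes, then every Gale
  vector is a zero of both forms, hence in the kernel of both by semidefiniteness, hence in the
  kernel of the perturbation (\<open>perturbation_kernel\<close>); this forces both \<open>z\<^sup>i\<close> and \<open>w\<close> to vanish,
  and \<open>z\<^sup>i = t1 z\<^sup>j + t2 z\<^sup>k\<close> reads \<open>0 = 0\<close>.

  Conversely, if \<open>z\<^sup>i = c1 z\<^sup>j + c2 z\<^sup>k\<close>, then the functional \<open>f(x) = c1 x\<^sub>j + c2 x\<^sub>k - x\<^sub>i\<close> vanishes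
  on the Gale space, so \<open>f\<close> is an affine function of the generating points
  (\<open>affine_if_orthogonal_to_dependencies\<close>). The perturbation with \<open>t1 = -s c1\<close>, \<open>t2 = -s c2\<close>
  changes \<open>|\<Sum> x\<^sub>a p\<^sup>a|\<^sup>2\<close> by
  \<open>s x\<^sub>i (x\<^sub>i + f(x)) = s (x\<^sub>i + f(x)/2)\<^sup>2 - (s/4) f(x)\<^sup>2\<close>. For small \<open>s > 0\<close> the negative square is
  absorbed by contracting the points along one direction, and the positive square is one additional
  coordinate; this gives explicit generating points of the perturbed matrix.
\<close>

section \<open>The quadratic form of a distance matrix\<close>

lemma EDM_bilinear_form:
  fixes D :: "real^'n^'n" and p :: "'n \<Rightarrow> 'a::euclidean_space" and x y :: "real^'n"
  assumes p: "generating_points D p"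
    and x: "(\<Sum>a\<in>UNIV. x $ a) = 0" and y: "(\<Sum>a\<in>UNIV. y $ a) = 0"
  shows "x \<bullet> (D *v y) = -2 * ((\<Sum>a\<in>UNIV. x $ a *\<^sub>R p a) \<bullet> (\<Sum>b\<in>UNIV. y $ b *\<^sub>R p b))"
proof -
  have Dab: "D $ a $ b = p a \<bullet> p a + p b \<bullet> p b - 2 * (p a \<bullet> p b)" for a b
    using p by (simp add: generating_points_def power2_norm_eq_inner inner_diff_left
        inner_diff_right inner_commute)
  have "x \<bullet> (D *v y) = (\<Sum>a\<in>UNIV. \<Sum>b\<in>UNIV. x $ a * y $ b * D $ a $ b)"
    by (simp add: inner_vec_def matrix_vector_mult_def sum_distrib_left mult_ac)
  also have "\<dots> = (\<Sum>a\<in>UNIV. \<Sum>b\<in>UNIV. x $ a * (p a \<bullet> p a) * y $ b)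
      + (\<Sum>a\<in>UNIV. \<Sum>b\<in>UNIV. x $ a * (y $ b * (p b \<bullet> p b)))
      - 2 * (\<Sum>a\<in>UNIV. \<Sum>b\<in>UNIV. x $ a * (y $ b * (p a \<bullet> p b)))"
    unfolding Dab sum_distrib_left sum.distrib[symmetric] sum_subtractf[symmetric]
    by (intro sum.cong refl) (simp add: algebra_simps)
  also have "(\<Sum>a\<in>UNIV. \<Sum>b\<in>UNIV. x $ a * (p a \<bullet> p a) * y $ b) = 0"
    by (simp add: sum_distrib_left[symmetric] y)
  also have "(\<Sum>a\<in>UNIV. \<Sum>b\<in>UNIV. x $ a * (y $ b * (p b \<bullet> p b))) = 0"
    by (simp add: sum_product[symmetric] x)
  also have "(\<Sum>a\<in>UNIV. \<Sum>b\<in>UNIV. x $ a * (y $ b * (p a \<bullet> p b)))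
      = (\<Sum>a\<in>UNIV. x $ a *\<^sub>R p a) \<bullet> (\<Sum>b\<in>UNIV. y $ b *\<^sub>R p b)"
    by (simp add: inner_sum_left) (simp add: inner_sum_right sum_distrib_left)
  finally show ?thesis by simp
qed

lemma EDM_quadratic_form:
  fixes D :: "real^'n^'n" and p :: "'n \<Rightarrow> 'a::euclidean_space"
  assumes "generating_points D p" and "(\<Sum>a\<in>UNIV. x $ a) = 0"
  shows "x \<bullet> (D *v x) = -2 * (norm (\<Sum>a\<in>UNIV. x $ a *\<^sub>R p a))\<^sup>2"
  using EDM_bilinear_form[OF assms(1,2,2)] by (simp add: power2_norm_eq_inner)

lemma Emat_bilinear_form:
  fixes x y :: "real^'n"
  assumes "i \<noteq> j"
  shows "x \<bullet> (Emat i j *v y) = x $ i * y $ j + x $ j * y $ i"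
proof -
  have "Emat i j $ a $ b * y $ b
      = (if b = j then if a = i then y $ b else 0 else 0)
      + (if b = i then if a = j then y $ b else 0 else 0)" for a b
    using assms by (auto simp: Emat_def)
  then have "(Emat i j *v y) $ a = (if a = i then y $ j else 0) + (if a = j then y $ i else 0)"
    for a
    by (simp add: matrix_vector_mult_def sum.distrib)
  moreover have "x $ a * ((if a = i then y $ j else 0) + (if a = j then y $ i else 0))
      = (if a = i then x $ a * y $ j else 0) + (if a = j then x $ a * y $ i else 0)" for a
    by (auto simp: distrib_left)
  ultimately show ?thesis
    by (simp add: inner_vec_def sum.distrib)
qed

lemma perturbed_bilinear_form:
  fixes x y :: "real^'n"
  assumes "i \<noteq> j" and "i \<noteq> k"
  shows "x \<bullet> ((D + t1 *\<^sub>R Emat i j + t2 *\<^sub>R Emat i k) *v y)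
    = x \<bullet> (D *v y) + (x $ i * (t1 * y $ j + t2 * y $ k) + (t1 * x $ j + t2 * x $ k) * y $ i)"
  by (simp add: matrix_vector_mult_add_rdistrib scaleR_matrix_vector_assoc[symmetric]
      inner_add_right Emat_bilinear_form[OF assms(1)] Emat_bilinear_form[OF assms(2)]
      algebra_simps)

text \<open>The two forms are negative semidefinite on vectors of coordinate sum \<open>0\<close>, so a common zero
  lies in both kernels, and the difference of the two bilinear forms vanishes there as well.\<close>

lemma perturbation_kernel:
  fixes x y :: "real^'n"
  assumes D: "is_EDM D" and D': "is_EDM (D + t1 *\<^sub>R Emat i j + t2 *\<^sub>R Emat i k)"
    and ij: "i \<noteq> j" and ik: "i \<noteq> k"
    and x: "(\<Sum>a\<in>UNIV. x $ a) = 0" and x0: "x \<bullet> (D *v x) = 0"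
    and z: "x $ i * (t1 * x $ j + t2 * x $ k) = 0"
    and y: "(\<Sum>a\<in>UNIV. y $ a) = 0"
  shows "y $ i * (t1 * x $ j + t2 * x $ k) + (t1 * y $ j + t2 * y $ k) * x $ i = 0"
proof -
  let ?D' = "D + t1 *\<^sub>R Emat i j + t2 *\<^sub>R Emat i k"
  have kernel: "y \<bullet> (M *v x) = 0" if M: "is_EDM M" and M0: "x \<bullet> (M *v x) = 0"
    for M :: "real^'n^'n"
  proof -
    obtain p :: "'n \<Rightarrow> real^'n" where p: "generating_points M p"
      using M unfolding is_EDM_def by blast
    have "(\<Sum>a\<in>UNIV. x $ a *\<^sub>R p a) = 0"
      using EDM_quadratic_form[OF p x] M0 by simp
    then show ?thesis
      using EDM_bilinear_form[OF p y x] by simp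
  qed
  have "x \<bullet> (?D' *v x) = 0"
    using perturbed_bilinear_form[OF ij ik, of x D t1 t2 x] x0 z by (simp add: mult.commute)
  from kernel[OF D' this] kernel[OF D x0] show ?thesis
    using perturbed_bilinear_form[OF ij ik, of y D t1 t2 x] by simp
qed

section \<open>The Gale space\<close>

lemma Jmat_fixes_sum_zero:
  fixes x :: "real^'n"
  assumes "(\<Sum>a\<in>UNIV. x $ a) = 0"
  shows "Jmat *v x = x"
proof -
  have "(\<chi> a b. 1 / real CARD('n)) *v x = (0 :: real^'n)"
    using assms
    by (simp add: vec_eq_iff matrix_vector_mult_def sum_divide_distrib[symmetric])
  then show ?thesis
    by (simp add: Jmat_def matrix_vector_mult_diff_rdistrib)
qed

lemma transpose_Jmat: "transpose (Jmat :: real^'n^'n) = Jmat"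
  by (auto simp: Jmat_def transpose_def vec_eq_iff mat_def)

text \<open>This makes the Gale space independent of the configuration: it only sees \<open>D\<close>. On vectors of
  coordinate sum \<open>0\<close> the projection \<open>J\<close> is the identity, so \<open>x\<^sup>T D x = -2 x\<^sup>T B x\<close>, and
  \<open>x\<^sup>T B x = |P\<^sup>T x|\<^sup>2\<close> vanishes only with all entries of \<open>P\<^sup>T x\<close>.\<close>

lemma gale_space_iff_isotropic:
  fixes D :: "real^'n^'n"
  assumes P: "configuration_matrix D P"
  shows "x \<in> gale_space (embedding_dim D) P
    \<longleftrightarrow> (\<Sum>a\<in>UNIV. x $ a) = 0 \<and> x \<bullet> (D *v x) = 0"
proof (cases "(\<Sum>a\<in>UNIV. x $ a) = 0")
  case True
  let ?R = "{..<embedding_dim D}"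
  have "Bmat D *v x = (- 1 / 2) *\<^sub>R (Jmat *v (D *v (Jmat *v x)))"
    by (simp only: Bmat_def scaleR_matrix_vector_assoc[symmetric] matrix_vector_mul_assoc[symmetric])
  then have "x \<bullet> (Bmat D *v x) = - 1 / 2 * (x \<bullet> (Jmat *v (D *v (Jmat *v x))))"
    by simp
  also have "x \<bullet> (Jmat *v (D *v (Jmat *v x))) = (Jmat *v x) \<bullet> (D *v (Jmat *v x))"
    by (metis dot_lmul_matrix transpose_Jmat transpose_matrix_vector)
  also have "\<dots> = x \<bullet> (D *v x)"
    by (simp add: Jmat_fixes_sum_zero[OF True])
  finally have B: "x \<bullet> (D *v x) = -2 * (x \<bullet> (Bmat D *v x))"
    by simp
  have "x \<bullet> (Bmat D *v x) = (\<Sum>a\<in>UNIV. \<Sum>b\<in>UNIV. \<Sum>s\<in>?R. P a s * x $ a * (P b s * x $ b))"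
    using P by (simp add: configuration_matrix_def inner_vec_def matrix_vector_mult_def
        sum_distrib_left sum_distrib_right mult_ac)
  also have "\<dots> = (\<Sum>a\<in>UNIV. \<Sum>s\<in>?R. \<Sum>b\<in>UNIV. P a s * x $ a * (P b s * x $ b))"
    by (intro sum.cong refl sum.swap)
  also have "\<dots> = (\<Sum>s\<in>?R. \<Sum>a\<in>UNIV. \<Sum>b\<in>UNIV. P a s * x $ a * (P b s * x $ b))"
    by (rule sum.swap)
  also have "\<dots> = (\<Sum>s\<in>?R. (\<Sum>a\<in>UNIV. P a s * x $ a)\<^sup>2)"
    by (simp add: power2_eq_square sum_product)
  finally have "x \<bullet> (D *v x) = 0 \<longleftrightarrow> (\<forall>s\<in>?R. (\<Sum>a\<in>UNIV. P a s * x $ a)\<^sup>2 = 0)"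
    using B by (simp add: sum_nonneg_eq_0_iff)
  then show ?thesis
    using True by (auto simp: gale_space_def)
qed (simp add: gale_space_def)

lemma gale_matrix_image:
  assumes "gale_matrix D P Z"
  shows "Z *v v \<in> gale_space (embedding_dim D) P"
proof -
  have "Z *v v \<in> span (columns Z)"
    by (rule matrix_vector_mult_in_columnspace)
  moreover have "columns Z = range (\<lambda>c. column c Z)"
    by (auto simp: columns_def)
  ultimately show ?thesis
    using assms by (simp add: gale_matrix_def)
qed

lemma matrix_vector_mult_component_row:
  fixes Z :: "real^'m^'n"
  shows "(Z *v v) $ a = Z $ a \<bullet> v"
  by (simp add: matrix_vector_mult_def inner_vec_def)

text \<open>The affine dependencies are the orthogonal complement of the span of the coordinate vectors
  of the points and the all-ones vector, so a vector orthogonal to all dependencies lies in that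
  span. The double complement theorem gives this without choosing a basis.\<close>

lemma affine_if_orthogonal_to_dependencies:
  fixes p :: "'n::finite \<Rightarrow> 'a::euclidean_space" and f :: "real^'n"
  assumes f: "\<And>x. (\<Sum>b\<in>UNIV. x $ b) = 0 \<Longrightarrow> (\<Sum>b\<in>UNIV. x $ b *\<^sub>R p b) = 0 \<Longrightarrow> f \<bullet> x = 0"
  obtains q h where "\<And>b. f $ b = q \<bullet> p b + h"
proof -
  define W :: "(real^'n) set" where "W = range (\<lambda>(q, h). \<chi> b. q \<bullet> p b + h)"
  have "linear (\<lambda>(q :: 'a, h). (\<chi> b. q \<bullet> p b + h) :: real^'n)"
    by (rule linearI) (auto simp: vec_eq_iff inner_add_left algebra_simps)
  then have W: "subspace W"
    unfolding W_def by (rule linear_subspace_image) simp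
  have "f \<bullet> x = 0" if "x \<in> orthogonal_comp W" for x
  proof (rule f)
    have orth: "(\<chi> b. q \<bullet> p b + h) \<bullet> x = 0" for q h
      using that by (fastforce simp: orthogonal_comp_def orthogonal_def W_def)
    show sum0: "(\<Sum>b\<in>UNIV. x $ b) = 0"
      using orth[of 0 1] by (simp add: inner_vec_def)
    have "q \<bullet> (\<Sum>b\<in>UNIV. x $ b *\<^sub>R p b) = 0" for q
      using orth[of q 0] by (simp add: inner_vec_def inner_sum_right mult.commute)
    then show "(\<Sum>b\<in>UNIV. x $ b *\<^sub>R p b) = 0"
      using inner_eq_zero_iff by blast
  qed
  then have "f \<in> orthogonal_comp (orthogonal_comp W)"
    by (simp add: orthogonal_comp_def orthogonal_def inner_commute)
  then have "f \<in> W"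
    by (simp add: orthogonal_comp_self[OF W])
  then show ?thesis
    using that by (auto simp: W_def)
qed

section \<open>Jointly yielding entries force a linear relation\<close>

text \<open>The vector \<open>|w| u + |u| w\<close> has inner products of the same sign with \<open>u\<close> and \<open>w\<close>; the
  assumption therefore makes both vanish, which is the equality case of Cauchy-Schwarz for
  \<open>u\<close> and \<open>- w\<close>.\<close>

lemma product_nonpos_imp_opposite:
  fixes u w :: "'a::real_inner"
  assumes nonpos: "\<And>v. (u \<bullet> v) * (w \<bullet> v) \<le> 0" and u: "u \<noteq> 0" and w: "w \<noteq> 0"
  shows "u = - (norm u / norm w) *\<^sub>R w"
proof -
  let ?v = "norm w *\<^sub>R u + norm u *\<^sub>R w"
  have v: "u \<bullet> ?v = norm u * (norm u * norm w + u \<bullet> w)"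
    "w \<bullet> ?v = norm w * (norm u * norm w + u \<bullet> w)"
    by (simp_all add: inner_add_right dot_square_norm power2_eq_square
        inner_commute[of w u] algebra_simps)
  have "(u \<bullet> ?v) * (w \<bullet> ?v) = (norm u * norm w) * (norm u * norm w + u \<bullet> w)\<^sup>2"
    unfolding v by (simp add: power2_eq_square mult_ac)
  with nonpos[of ?v] have "(norm u * norm w) * (norm u * norm w + u \<bullet> w)\<^sup>2 \<le> 0"
    by simp
  then have "norm u * norm w + u \<bullet> w = 0"
    using u w by (simp add: mult_le_0_iff)
  then have "u \<bullet> (- w) = norm u * norm (- w)"
    by simp
  then have "norm u *\<^sub>R (- w) = norm w *\<^sub>R u"
    using norm_cauchy_schwarz_eq[of u "- w"] by simp
  then have "(1 / norm w) *\<^sub>R (norm w *\<^sub>R u) = (1 / norm w) *\<^sub>R (norm u *\<^sub>R (- w))"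
    by simp
  then show ?thesis
    using w by simp
qed

lemma jointly_yielding_imp_gale_relation:
  fixes D :: "real^'n^'n" and Z :: "real^'m^'n"
  assumes D: "is_EDM D" and P: "configuration_matrix D P" and Z: "gale_matrix D P Z"
    and ij: "i \<noteq> j" and ik: "i \<noteq> k" and jk: "j \<noteq> k"
    and jy: "jointly_yielding D i j k"
  obtains c1 c2 where "c1 \<noteq> 0" "c2 \<noteq> 0" "Z $ i = c1 *\<^sub>R (Z $ j) + c2 *\<^sub>R (Z $ k)"
proof -
  obtain t1 t2 where t: "t1 \<noteq> 0" "t2 \<noteq> 0"
    and D': "is_EDM (D + t1 *\<^sub>R Emat i j + t2 *\<^sub>R Emat i k)" (is "is_EDM ?D'")
    using jy unfolding jointly_yielding_def by blast
  define w where "w = t1 *\<^sub>R (Z $ j) + t2 *\<^sub>R (Z $ k)"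
  have sum0: "(\<Sum>a\<in>UNIV. (Z *v v) $ a) = 0" and iso: "(Z *v v) \<bullet> (D *v (Z *v v)) = 0" for v
    using gale_matrix_image[OF Z, of v] gale_space_iff_isotropic[OF P] by auto
  have wv: "w \<bullet> v = t1 * (Z *v v) $ j + t2 * (Z *v v) $ k" for v
    by (simp add: w_def inner_add_left matrix_vector_mult_component_row)
  have nonpos: "(Z $ i \<bullet> v) * (w \<bullet> v) \<le> 0" for v
  proof -
    obtain p :: "'n \<Rightarrow> real^'n" where "generating_points ?D' p"
      using D' unfolding is_EDM_def by blast
    then have "(Z *v v) \<bullet> (?D' *v (Z *v v)) \<le> 0"
      using EDM_quadratic_form[OF _ sum0[of v]] by fastforce
    then show ?thesis
      using perturbed_bilinear_form[OF ij ik, of "Z *v v" D t1 t2 "Z *v v"] iso[of v]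
      by (simp add: wv matrix_vector_mult_component_row algebra_simps)
  qed
  show ?thesis
  proof (cases "Z $ i = 0 \<or> w = 0")
    case True
    have kernel: "y $ i * (w \<bullet> v) + (t1 * y $ j + t2 * y $ k) * (Z $ i \<bullet> v) = 0"
      if "(\<Sum>a\<in>UNIV. y $ a) = 0" for y v
    proof -
      have "(Z *v v) $ i * (t1 * (Z *v v) $ j + t2 * (Z *v v) $ k) = (Z $ i \<bullet> v) * (w \<bullet> v)"
        by (simp add: wv matrix_vector_mult_component_row)
      also have "\<dots> = 0"
        using True by auto
      finally have "(Z *v v) $ i * (t1 * (Z *v v) $ j + t2 * (Z *v v) $ k) = 0" .
      from perturbation_kernel[OF D D' ij ik sum0 iso this that] show ?thesis
        by (simp add: wv matrix_vector_mult_component_row)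
    qed
    have sum_axis: "(\<Sum>a\<in>UNIV. (axis l 1 - axis m 1 :: real^'n) $ a) = 0" for l m
      by (simp add: axis_def sum_subtractf)
    \<comment> \<open>Testing against \<open>e\<^sub>j - e\<^sub>i\<close> relates the two functionals by the nonzero factor \<open>t1\<close>, so
      if one of them vanishes then so does the other.\<close>
    have "w \<bullet> v = t1 * (Z $ i \<bullet> v)" for v
      using kernel[OF sum_axis[of j i], of v] ij ik jk by (simp add: axis_def)
    then have "w = t1 *\<^sub>R (Z $ i)"
      by (intro vector_eq_rdot[THEN iffD1]) simp
    with True t have "Z $ i = 0" "w = 0"
      by auto
    then show ?thesis
      using that[OF t] by (simp add: w_def)
  next
    case False
    let ?c = "- (norm (Z $ i) / norm w)"
    have "Z $ i = ?c *\<^sub>R w"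
      using product_nonpos_imp_opposite[OF nonpos] False by blast
    then have "Z $ i = (?c * t1) *\<^sub>R (Z $ j) + (?c * t2) *\<^sub>R (Z $ k)"
      by (simp add: w_def scaleR_add_right)
    then show ?thesis
      using that[of "?c * t1" "?c * t2"] False t by simp
  qed
qed

section \<open>A linear relation yields a perturbation\<close>

text \<open>This absorbs the negative square \<open>- (s/4) f(x)\<^sup>2\<close>: there \<open>f(x)\<close> is \<open>q \<bullet> (\<Sum> x\<^sub>a p\<^sup>a)\<close>, because
  \<open>f\<close> is affine in the points and \<open>x\<close> has coordinate sum \<open>0\<close>.\<close>

lemma exists_contraction_along:
  fixes q :: "'a::real_inner"
  obtains \<kappa> s :: real where "s > 0"
    and "\<And>y. (norm (y - (\<kappa> * (q \<bullet> y)) *\<^sub>R q))\<^sup>2 = (norm y)\<^sup>2 - s / 4 * (q \<bullet> y)\<^sup>2"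
proof
  \<comment> \<open>The expansion gives \<open>s / 4 = 2 \<kappa> - \<kappa>\<^sup>2 |q|\<^sup>2\<close>, positive as soon as \<open>0 < \<kappa> |q|\<^sup>2 < 2\<close>; the
    added \<open>1\<close> covers \<open>q = 0\<close>.\<close>
  define \<kappa> where "\<kappa> = 1 / (1 + q \<bullet> q)"
  have pos: "0 < 1 + q \<bullet> q"
    by (simp add: add_pos_nonneg)
  have "\<kappa> > 0" and "\<kappa> * (q \<bullet> q) < 2"
    using pos by (simp_all add: \<kappa>_def field_simps)
  then show "4 * (\<kappa> * (2 - \<kappa> * (q \<bullet> q))) > 0"
    by simp
  show "(norm (y - (\<kappa> * (q \<bullet> y)) *\<^sub>R q))\<^sup>2
      = (norm y)\<^sup>2 - 4 * (\<kappa> * (2 - \<kappa> * (q \<bullet> q))) / 4 * (q \<bullet> y)\<^sup>2" for y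
    unfolding power2_norm_eq_inner
    by (simp add: inner_diff_left inner_diff_right inner_commute[of y q] power2_eq_square
        field_simps)
qed

text \<open>The new points live in the old space times \<open>\<real>\<close>: the contraction along \<open>q\<close> and the extra
  coordinate \<open>\<surd>s (x\<^sub>i + f(x)/2)\<close> realise the completed square described at the beginning.\<close>

lemma gale_relation_imp_jointly_yielding:
  fixes D :: "real^'n^'n" and Z :: "real^'m^'n"
  assumes D: "is_EDM D" and P: "configuration_matrix D P" and Z: "gale_matrix D P Z"
    and ij: "i \<noteq> j" and ik: "i \<noteq> k" and jk: "j \<noteq> k"
    and c: "c1 \<noteq> 0" "c2 \<noteq> 0" and rel: "Z $ i = c1 *\<^sub>R (Z $ j) + c2 *\<^sub>R (Z $ k)"
  shows "jointly_yielding D i j k"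
proof -
  obtain p :: "'n \<Rightarrow> real^'n" where p: "generating_points D p"
    using D unfolding is_EDM_def by blast
  define f :: "real^'n" where "f = c1 *\<^sub>R axis j 1 + c2 *\<^sub>R axis k 1 - axis i 1"
  have f_inner: "f \<bullet> x = c1 * x $ j + c2 * x $ k - x $ i" for x
    by (simp add: f_def inner_add_left inner_diff_left inner_axis')
  have "f \<bullet> x = 0"
    if x: "(\<Sum>b\<in>UNIV. x $ b) = 0" "(\<Sum>b\<in>UNIV. x $ b *\<^sub>R p b) = 0" for x
  proof -
    have "x \<bullet> (D *v x) = 0"
      using EDM_quadratic_form[OF p x(1)] x(2) by simp
    then have "x \<in> span (range (\<lambda>c. column c Z))"
      using gale_space_iff_isotropic[OF P] x(1) Z by (simp add: gale_matrix_def)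
    moreover have "orthogonal f y" if "y \<in> range (\<lambda>c. column c Z)" for y
      using that rel by (auto simp: orthogonal_def f_inner column_def)
    ultimately show ?thesis
      using orthogonal_to_span[of x _ f] by (simp add: orthogonal_def)
  qed
  then obtain q h where qh: "\<And>b. f $ b = q \<bullet> p b + h"
    using affine_if_orthogonal_to_dependencies[of p f] by blast
  obtain \<kappa> s where s: "s > 0"
    and contr: "\<And>y. (norm (y - (\<kappa> * (q \<bullet> y)) *\<^sub>R q))\<^sup>2 = (norm y)\<^sup>2 - s / 4 * (q \<bullet> y)\<^sup>2"
    using exists_contraction_along[of q] by blast
  define g where "g b = axis i 1 $ b + f $ b / 2" for b
  define p' where "p' b = (p b - (\<kappa> * (q \<bullet> p b)) *\<^sub>R q, sqrt s * g b)" for b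
  let ?D' = "D + (- s * c1) *\<^sub>R Emat i j + (- s * c2) *\<^sub>R Emat i k"
  have "generating_points ?D' p'"
    unfolding generating_points_def
  proof (intro allI)
    fix a b
    have diff: "p' a - p' b
        = ((p a - p b) - (\<kappa> * (q \<bullet> (p a - p b))) *\<^sub>R q, sqrt s * (g a - g b))"
      by (simp add: p'_def inner_diff_right algebra_simps)
    have "(norm (p' a - p' b))\<^sup>2
        = (norm ((p a - p b) - (\<kappa> * (q \<bullet> (p a - p b))) *\<^sub>R q))\<^sup>2 + s * (g a - g b)\<^sup>2"
      unfolding diff using s by (simp add: norm_Pair power_mult_distrib)
    also have "\<dots> = D $ a $ b - s / 4 * (f $ a - f $ b)\<^sup>2 + s * (g a - g b)\<^sup>2"
      using p unfolding contr by (simp add: generating_points_def qh inner_diff_right)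
    also have "\<dots> = D $ a $ b
        + s * ((axis i 1 $ a - axis i 1 $ b) * ((axis i 1 $ a - axis i 1 $ b) + (f $ a - f $ b)))"
      by (simp add: g_def power2_eq_square field_simps)
    also have "\<dots> = ?D' $ a $ b"
      using ij ik jk by (auto simp: f_def axis_def Emat_def)
    finally show "?D' $ a $ b = (norm (p' a - p' b))\<^sup>2" ..
  qed
  then have "is_EDM ?D'"
    by (rule is_EDM_if_generating_points)
  moreover have "- s * c1 \<noteq> 0" "- s * c2 \<noteq> 0"
    using s c by simp_all
  ultimately show ?thesis
    unfolding jointly_yielding_def by blast
qed

theorem theorem5p1:
  fixes D :: "real^'n^'n" and P :: "'n \<Rightarrow> nat \<Rightarrow> real" and Z :: "real^'m^'n"
    and r :: nat and i j k :: 'n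
  assumes "CARD('n) \<ge> 4"
    and "is_EDM D"
    and "embedding_dim D = r"
    and "r \<le> CARD('n) - 2"
    and "CARD('m) = CARD('n) - r - 1"
    and "configuration_matrix D P"
    and "gale_matrix D P Z"
    and "i \<noteq> j" and "i \<noteq> k" and "j \<noteq> k"
    and "unyielding D i j" and "unyielding D i k"
  shows "jointly_yielding D i j k \<longleftrightarrow>
    (\<exists>c1 c2. c1 \<noteq> 0 \<and> c2 \<noteq> 0 \<and> Z $ i = c1 *\<^sub>R (Z $ j) + c2 *\<^sub>R (Z $ k))"
proof
  assume "jointly_yielding D i j k"
  from jointly_yielding_imp_gale_relation[OF assms(2,6-10) this]
  show "\<exists>c1 c2. c1 \<noteq> 0 \<and> c2 \<noteq> 0 \<and> Z $ i = c1 *\<^sub>R (Z $ j) + c2 *\<^sub>R (Z $ k)"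
    by blast
next
  assume "\<exists>c1 c2. c1 \<noteq> 0 \<and> c2 \<noteq> 0 \<and> Z $ i = c1 *\<^sub>R (Z $ j) + c2 *\<^sub>R (Z $ k)"
  then show "jointly_yielding D i j k"
    using gale_relation_imp_jointly_yielding[OF assms(2,6-10)] by blast
qed

end
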